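(* Let $n\ge 1$. For each alternating sign matrix $A=(a_{ij})\in\mathcal{A}_n$, $$\beta(A)=\sum_{\substack{1\le i<j\le n\\ 1\le k<l\le n}}(l-k)\,a_{jk}\,a_{il}.$$
   Context: An $n\times n$ matrix $A=(a_{ij})$ is an alternating sign matrix (ASM) if for all $i,j$: $a_{ij}\in\{-1,0,1\}$, $\sum_{k=1}^{j}a_{ik}\in\{0,1\}$, $\sum_{k=1}^{i}a_{kj}\in\{0,1\}$, and $\sum_{k=1}^{n}a_{ik}=\sum_{k=1}^{n}a_{kj}=1$. $\mathcal{A}_n$ is the set of all ASMs of size $n$. The symmetric group $S_n$ is regarded as a subset of $\mathcal{A}_n$ by identifying $w\in S_n$ with its permutation matrix $(w_{ij})$, where $w_{ij}=1$ if $j=w(i)$ and $w_{ij}=0$ otherwise. The corner sum matrix of $A\in\mathcal{A}_n$ is $\widetilde{A}(i,j)=\sum_{p\le i,\,q\le j}a_{pq}$. The ASM order on $\mathcal{A}_n$ is: $A\le B$ iff $\widetilde{A}(i,j)\ge\widetilde{B}(i,j)$ for all $i,j$. A permutation $v\in S_n$ is bigrassmannian if there exists a unique pair $(i,j)$, with $1\le i,j\le n-1$, such that $v^{-1}(i)>v^{-1}(i+1)$ and $v(j)>v(j+1)$. (It is known that the bigrassmannian permutations are exactly the join-irreducible elements of $(\mathcal{A}_n,\le)$, i.e. the ASMs covering exactly one element.) For $B\in\mathcal{A}_n$, $\beta(B)=|\{A\in\mathcal{A}_n \mid A\le B \text{ and } A \text{ is bigrassmannian}\}|$. *)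

theory Defs
  imports "Jordan_Normal_Form.Matrix" "HOL-Combinatorics.Permutations"
begin

text \<open>
  Matrices are 0-based, so all row and column indices, and the letters permuted by a permutation,
  range over \<open>{..<n}\<close> in place of \<open>{1..n}\<close>.
\<close>

definition ASM :: "nat \<Rightarrow> int mat set" where
  "ASM n = {A \<in> carrier_mat n n.
     (\<forall>i<n. \<forall>j<n. A $$ (i, j) \<in> {-1, 0, 1}
        \<and> (\<Sum>k\<le>j. A $$ (i, k)) \<in> {0, 1}
        \<and> (\<Sum>k\<le>i. A $$ (k, j)) \<in> {0, 1}
        \<and> (\<Sum>k<n. A $$ (i, k)) = 1
        \<and> (\<Sum>k<n. A $$ (k, j)) = 1)}"

definition perm_mat :: "nat \<Rightarrow> (nat \<Rightarrow> nat) \<Rightarrow> int mat" where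
  "perm_mat n w = mat n n (\<lambda>(i, j). if j = w i then 1 else 0)"

definition corner_sum :: "int mat \<Rightarrow> nat \<Rightarrow> nat \<Rightarrow> int" where
  "corner_sum A i j = (\<Sum>p\<le>i. \<Sum>q\<le>j. A $$ (p, q))"

definition asm_le :: "nat \<Rightarrow> int mat \<Rightarrow> int mat \<Rightarrow> bool" where
  "asm_le n A B \<longleftrightarrow> (\<forall>i<n. \<forall>j<n. corner_sum A i j \<ge> corner_sum B i j)"

text \<open>
  \<open>inv_into UNIV v\<close> is the inverse permutation; its usual notation \<open>inv\<close> clashes with the HOL-Algebra syntax
  loaded by \<open>Jordan_Normal_Form\<close>.
\<close>

definition bigrassmannian :: "nat \<Rightarrow> (nat \<Rightarrow> nat) \<Rightarrow> bool" where
  "bigrassmannian n v \<longleftrightarrow> v permutes {..<n} \<and>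
     (\<exists>!(i, j). Suc i < n \<and> Suc j < n \<and> inv_into UNIV v i > inv_into UNIV v (Suc i) \<and> v j > v (Suc j))"

definition asm_beta :: "nat \<Rightarrow> int mat \<Rightarrow> nat" where
  "asm_beta n B =
     card {A \<in> ASM n. asm_le n A B \<and> (\<exists>v. bigrassmannian n v \<and> A = perm_mat n v)}"

end

theory Submission imports Defs begin

text \<open>
  A bigrassmannian permutation exchanges two adjacent blocks of the identity. If \<open>v\<close> has its descent
  after position \<open>I\<close>, its inverse after position \<open>J\<close>, and fixes exactly the first \<open>a\<close> letters before
  the exchange, then the corner sums of \<open>v\<close> are the pointwise largest corner sums of an alternating
  sign matrix whose \<open>I \<times> J\<close> corner sum is at most \<open>a\<close>. Hence \<open>v \<le> A\<close> iff the \<open>I \<times> J\<close> corner sum of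
  \<open>A\<close> is at most \<open>a\<close>, and \<open>\<beta>(A)\<close> is the sum over all \<open>I, J\<close> of \<open>min I J\<close> minus the \<open>I \<times> J\<close> corner sum.
  On the other side, \<open>l - k\<close> counts the \<open>m\<close> with \<open>k \<le> m < l\<close>; for fixed \<open>m\<close> the double sum counts the
  inversions of the sequence of partial row sums up to column \<open>m\<close>, a sequence of zeros and ones
  with \<open>m + 1\<close> ones.
\<close>

section \<open>Corner sums of alternating sign matrices\<close>

text \<open>Indexed by the numbers of rows and columns instead of the last indices, so that the
  empty corners are available as boundary values.\<close>

definition corner :: "int mat \<Rightarrow> nat \<Rightarrow> nat \<Rightarrow> int" where
  "corner A p q = (\<Sum>i<p. \<Sum>k<q. A $$ (i, k))"

lemma corner_sum_eq_corner: "corner_sum A i j = corner A (Suc i) (Suc j)"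
  by (simp add: corner_sum_def corner_def lessThan_Suc_atMost)

lemma corner_Suc: "corner A (Suc p) q = corner A p q + (\<Sum>k<q. A $$ (p, k))"
  by (simp add: corner_def)

lemma ASM_row_partial:
  assumes "A \<in> ASM n" "i < n" "q \<le> n"
  shows "(\<Sum>k<q. A $$ (i, k)) \<in> {0, 1}"
proof (cases q)
  case (Suc j)
  with assms show ?thesis
    unfolding ASM_def by (simp add: lessThan_Suc_atMost)
qed simp

lemma ASM_row_total: "A \<in> ASM n \<Longrightarrow> i < n \<Longrightarrow> (\<Sum>k<n. A $$ (i, k)) = 1"
  unfolding ASM_def by auto

text \<open>Lets every column fact below be read off from its row counterpart.\<close>

lemma ASM_transpose:
  assumes "A \<in> ASM n"
  shows "transpose_mat A \<in> ASM n"
proof -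
  have A: "A \<in> carrier_mat n n" using assms by (simp add: ASM_def)
  have t: "transpose_mat A $$ (i, j) = A $$ (j, i)" if "i < n" "j < n" for i j
    using A that by auto
  have "(\<Sum>k\<le>j. transpose_mat A $$ (i, k)) = (\<Sum>k\<le>j. A $$ (k, i))"
    "(\<Sum>k\<le>j. transpose_mat A $$ (k, i)) = (\<Sum>k\<le>j. A $$ (i, k))"
    if "i < n" "j < n" for i j
    using that by (auto intro!: sum.cong t)
  moreover have "(\<Sum>k<n. transpose_mat A $$ (i, k)) = (\<Sum>k<n. A $$ (k, i))"
    "(\<Sum>k<n. transpose_mat A $$ (k, i)) = (\<Sum>k<n. A $$ (i, k))"
    if "i < n" for i
    using that by (auto intro!: sum.cong t)
  ultimately show ?thesis
    using assms A t unfolding ASM_def by auto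
qed

lemma corner_transpose:
  assumes "A \<in> carrier_mat n n" "p \<le> n" "q \<le> n"
  shows "corner (transpose_mat A) q p = corner A p q"
proof -
  have "corner (transpose_mat A) q p = (\<Sum>i<q. \<Sum>k<p. A $$ (k, i))"
    unfolding corner_def using assms by (intro sum.cong refl) auto
  also have "\<dots> = corner A p q"
    unfolding corner_def by (rule sum.swap)
  finally show ?thesis .
qed

text \<open>Truncated subtraction merges two facts: dropping terms cannot raise the sum
  (\<open>p' \<le> p\<close>), and each added term raises it by at most one.\<close>

lemma sum_zero_one_le:
  fixes f :: "nat \<Rightarrow> int"
  assumes f: "\<And>i. i < n \<Longrightarrow> f i \<in> {0, 1}" and "p' \<le> n" "p \<le> n"
  shows "(\<Sum>i<p'. f i) \<le> (\<Sum>i<p. f i) + int (p' - p)"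
proof (cases "p' \<le> p")
  case True
  have "(\<Sum>i<p'. f i) \<le> (\<Sum>i<p. f i)"
  proof (rule sum_mono2)
    show "0 \<le> f b" if "b \<in> {..<p} - {..<p'}" for b
      using f[of b] that assms(3) by auto
  qed (use True in auto)
  then show ?thesis by simp
next
  case False
  then have "(\<Sum>i<p'. f i) = (\<Sum>i<p. f i) + (\<Sum>i=p..<p'. f i)"
    by (simp add: lessThan_atLeast0 sum.atLeastLessThan_concat)
  moreover have "(\<Sum>i=p..<p'. f i) \<le> (\<Sum>i=p..<p'. 1)"
  proof (rule sum_mono)
    show "f i \<le> 1" if "i \<in> {p..<p'}" for i
      using f[of i] that assms(2) by auto
  qed
  ultimately show ?thesis using False by simp
qed

lemma corner_le_rows:
  assumes "A \<in> ASM n" "p' \<le> n" "p \<le> n" "q \<le> n"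
  shows "corner A p' q \<le> corner A p q + int (p' - p)"
  unfolding corner_def
  by (rule sum_zero_one_le[where n = n]) (use assms ASM_row_partial in auto)

lemma corner_le_columns:
  assumes "A \<in> ASM n" "p \<le> n" "q' \<le> n" "q \<le> n"
  shows "corner A p q' \<le> corner A p q + int (q' - q)"
proof -
  have "A \<in> carrier_mat n n" using assms by (simp add: ASM_def)
  then show ?thesis
    using corner_le_rows[OF ASM_transpose[OF assms(1)] assms(3,4,2)] assms
    by (simp add: corner_transpose)
qed

lemma corner_nonneg:
  assumes "A \<in> ASM n" "p \<le> n" "q \<le> n"
  shows "0 \<le> corner A p q"
  using corner_le_rows[OF assms(1) _ assms(2,3), of 0] by (simp add: corner_def)

lemma corner_le_min:
  assumes "A \<in> ASM n" "p \<le> n" "q \<le> n"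
  shows "corner A p q \<le> int (min p q)"
  using corner_le_rows[OF assms(1,2) _ assms(3), of 0]
    corner_le_columns[OF assms(1,2,3), of 0]
  by (simp add: corner_def)

lemma corner_full_columns:
  assumes "A \<in> ASM n" "p \<le> n"
  shows "corner A p n = int p"
  using assms by (simp add: corner_def ASM_row_total)

lemma corner_full_rows:
  assumes "A \<in> ASM n" "q \<le> n"
  shows "corner A n q = int q"
proof -
  have "A \<in> carrier_mat n n" using assms by (simp add: ASM_def)
  then show ?thesis
    using corner_full_columns[OF ASM_transpose[OF assms(1)] assms(2)] assms
    by (simp add: corner_transpose)
qed

text \<open>The first \<open>q\<close> columns sum to \<open>q\<close>, and each of the
  \<open>n - p\<close> rows outside the corner contributes at most one to that.\<close>

lemma corner_lower_bound:
  assumes "A \<in> ASM n" "p \<le> n" "q \<le> n"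
  shows "int p + int q \<le> int n + corner A p q"
  using corner_le_rows[OF assms(1) _ assms(2,3), of n] corner_full_rows[OF assms(1,3)] assms
  by simp

section \<open>Permutation matrices as alternating sign matrices\<close>

lemma perm_mat_row_sum:
  assumes "i < n" "q \<le> n"
  shows "(\<Sum>k<q. perm_mat n v $$ (i, k)) = of_bool (v i < q)"
proof -
  have "(\<Sum>k<q. perm_mat n v $$ (i, k)) = (\<Sum>k<q. if k = v i then 1 else 0)"
    using assms by (intro sum.cong refl) (simp add: perm_mat_def)
  then show ?thesis by simp
qed

lemma perm_mat_column_sum:
  assumes v: "v permutes {..<n}" and "j < n" "q \<le> n"
  shows "(\<Sum>k<q. perm_mat n v $$ (k, j)) = of_bool (inv_into UNIV v j < q)"
proof -
  have "(\<Sum>k<q. perm_mat n v $$ (k, j)) = (\<Sum>k<q. if k = inv_into UNIV v j then 1 else 0)"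
    using assms permutes_inv_eq[OF v, of j]
    by (intro sum.cong refl) (auto simp: perm_mat_def)
  then show ?thesis by simp
qed

lemma perm_mat_ASM:
  assumes v: "v permutes {..<n}"
  shows "perm_mat n v \<in> ASM n"
proof -
  have "inv_into UNIV v j < n" if "j < n" for j
    using permutes_in_image[OF permutes_inv[OF v]] that by auto
  moreover have "v j < n" if "j < n" for j
    using permutes_in_image[OF v] that by auto
  moreover have "perm_mat n v $$ (i, j) \<in> {-1, 0, 1}" if "i < n" "j < n" for i j
    using that by (simp add: perm_mat_def)
  moreover have "perm_mat n v \<in> carrier_mat n n" by (simp add: perm_mat_def)
  ultimately show ?thesis
    unfolding ASM_def lessThan_Suc_atMost[symmetric] mem_Collect_eq
    by (simp add: perm_mat_row_sum perm_mat_column_sum[OF v] del: sum.lessThan_Suc insert_iff)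
      (simp add: of_bool_def)
qed

section \<open>Block swaps and their corner sums\<close>

text \<open>Under \<open>a < I\<close> and \<open>a < J\<close>, the blocks have lengths
  \<open>I - a\<close> and \<open>J - a\<close>; \<open>I\<close> and \<open>J\<close> play
  symmetric roles under inversion.\<close>

definition block_swap :: "nat \<Rightarrow> nat \<Rightarrow> nat \<Rightarrow> nat \<Rightarrow> nat" where
  "block_swap I J a x =
     (if x < a then x else if x < I then x + (J - a)
      else if x < I + J - a then x - (I - a) else x)"

lemma block_swap_inverse:
  assumes "a < I" "a < J"
  shows "block_swap J I a (block_swap I J a x) = x"
  using assms by (auto simp: block_swap_def)

lemma block_swap_permutes:
  assumes "a < I" "a < J" "I + J \<le> n + a"
  shows "block_swap I J a permutes {..<n}"
proof (rule bij_imp_permutes)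
  show "bij_betw (block_swap I J a) {..<n} {..<n}"
  proof (rule bij_betwI[where g = "block_swap J I a"])
    show "block_swap I J a \<in> {..<n} \<rightarrow> {..<n}" "block_swap J I a \<in> {..<n} \<rightarrow> {..<n}"
      using assms by (auto simp: block_swap_def)
  qed (use assms block_swap_inverse in auto)
  show "block_swap I J a x = x" if "x \<notin> {..<n}" for x
    using that assms by (auto simp: block_swap_def)
qed

lemma inv_block_swap:
  assumes "a < I" "a < J"
  shows "inv_into UNIV (block_swap I J a) = block_swap J I a"
  using assms by (intro inv_unique_comp) (auto simp: block_swap_inverse)

lemma block_swap_descent:
  assumes "a < I" "a < J"
  shows "block_swap I J a x > block_swap I J a (Suc x) \<longleftrightarrow> Suc x = I"
  using assms by (auto simp: block_swap_def)

lemma block_swap_bigrassmannian: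
  assumes "a < I" "a < J" "I + J \<le> n + a"
  shows "bigrassmannian n (block_swap I J a)"
  unfolding bigrassmannian_def
proof
  show "block_swap I J a permutes {..<n}"
    by (rule block_swap_permutes) (fact assms)+
  show "\<exists>!(i, j). Suc i < n \<and> Suc j < n
      \<and> inv_into UNIV (block_swap I J a) i > inv_into UNIV (block_swap I J a) (Suc i)
      \<and> block_swap I J a j > block_swap I J a (Suc j)"
    unfolding inv_block_swap[OF assms(1,2)] block_swap_descent[OF assms(1,2)]
      block_swap_descent[OF assms(2,1)]
    \<comment> \<open>The first component is the descent of the inverse, hence comes from
      \<open>J\<close>; both are shifted by one since a descent is recorded by its left
      position.\<close>
    by (rule ex1I[where a = "(J - 1, I - 1)"]) (use assms in auto)
qed

text \<open>Row \<open>p\<close> adds one to the corner sum exactly when \<open>p\<close> is sent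
  below \<open>q\<close>, which gives an induction over the rows.\<close>

lemma corner_block_swap:
  assumes "a < I" "a < J" "p \<le> n" "q \<le> n"
  shows "corner (perm_mat n (block_swap I J a)) p q = int (min (min p q) (a + (p - I) + (q - J)))"
  using assms(3)
proof (induction p)
  case 0
  then show ?case by (simp add: corner_def)
next
  case (Suc p)
  \<comment> \<open>The block lengths \<open>s\<close> and \<open>t\<close> replace the truncated
    differences in \<open>block_swap\<close>.\<close>
  obtain s t where "I = a + s" "J = a + t" "0 < s" "0 < t"
    using assms less_imp_add_positive by metis
  then have "min (min (Suc p) q) (a + (Suc p - I) + (q - J))
      = min (min p q) (a + (p - I) + (q - J)) + of_bool (block_swap I J a p < q)"
    by (cases "p < I"; cases "q < J") (auto simp: block_swap_def min_def Suc_diff_le)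
  with Suc assms show ?case
    by (simp add: corner_Suc perm_mat_row_sum)
qed

text \<open>At \<open>(I, J)\<close> the corner sum of the block swap is \<open>a\<close>.
  Conversely, going from \<open>(I, J)\<close> to \<open>(p, q)\<close> raises a corner sum of
  \<open>A\<close> by at most \<open>(p - I) + (q - J)\<close>, and \<open>min p q\<close> always
  bounds it.\<close>

lemma block_swap_le_iff:
  assumes "a < I" "a < J" "I + J \<le> n + a" and A: "A \<in> ASM n"
  shows "asm_le n (perm_mat n (block_swap I J a)) A \<longleftrightarrow> corner A I J \<le> int a"
proof
  assume "asm_le n (perm_mat n (block_swap I J a)) A"
  moreover have "I - 1 < n" "J - 1 < n" using assms by auto
  ultimately have "corner A I J \<le> corner (perm_mat n (block_swap I J a)) I J"
    unfolding asm_le_def corner_sum_eq_corner using assms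
    by (metis One_nat_def Suc_pred gr_implies_not0 neq0_conv)
  then show "corner A I J \<le> int a"
    using assms by (simp add: corner_block_swap)
next
  assume IJ: "corner A I J \<le> int a"
  have "corner A p q \<le> corner (perm_mat n (block_swap I J a)) p q" if "p \<le> n" "q \<le> n" for p q
  proof -
    have "corner A p q \<le> corner A I J + int (p - I) + int (q - J)"
      using corner_le_rows[OF A, of p I q] corner_le_columns[OF A, of I q J] assms that by simp
    with IJ corner_le_min[OF A that] show ?thesis
      using assms that by (simp add: corner_block_swap)
  qed
  then show "asm_le n (perm_mat n (block_swap I J a)) A"
    unfolding asm_le_def corner_sum_eq_corner by simp
qed

section \<open>Every bigrassmannian permutation is a block swap\<close>

text \<open>The value at \<open>x\<close> is its rank, the number of positions with a smaller value,
  so relative order determines the permutation.\<close>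

lemma permutes_eqI_order:
  fixes v w :: "nat \<Rightarrow> nat"
  assumes v: "v permutes {..<n}" and w: "w permutes {..<n}"
    and le: "\<And>x y. x < n \<Longrightarrow> y < n \<Longrightarrow> v x < v y \<longleftrightarrow> w x < w y"
  shows "v = w"
proof -
  have rank: "card {y. y < n \<and> u y < u x} = u x" if u: "u permutes {..<n}" and "x < n" for u x
  proof -
    have "u ` {y. y < n \<and> u y < u x} = {..<u x}"
    proof (intro Set.set_eqI iffI)
      fix z assume "z \<in> {..<u x}"
      moreover have "u x < n" using permutes_in_image[OF u] that(2) by auto
      ultimately have "z \<in> u ` {..<n}" using permutes_image[OF u] by auto
      with \<open>z \<in> {..<u x}\<close> show "z \<in> u ` {y. y < n \<and> u y < u x}" by auto
    qed auto
    then show ?thesis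
      by (metis card_image card_lessThan inj_on_subset permutes_inj[OF u] subset_UNIV)
  qed
  have "v x = w x" for x
  proof (cases "x < n")
    case True
    then have "{y. y < n \<and> v y < v x} = {y. y < n \<and> w y < w x}" using le by auto
    then show ?thesis using rank[OF v True] rank[OF w True] by simp
  next
    case False
    then show ?thesis using v w by (simp add: permutes_not_in)
  qed
  then show ?thesis by auto
qed

lemma mono_of_no_descent:
  fixes f :: "nat \<Rightarrow> nat"
  assumes "\<And>z. x \<le> z \<Longrightarrow> z < y \<Longrightarrow> f z \<le> f (Suc z)" "x \<le> y"
  shows "f x \<le> f y"
  using assms(2,1)
proof (induction y rule: dec_induct)
  case (step m)
  have "f x \<le> f m" by (rule step.IH) (use step.prems in auto)
  also have "\<dots> \<le> f (Suc m)" using step.prems step.hyps by auto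
  finally show ?case .
qed simp

lemma initial_segment:
  fixes X :: "nat set"
  assumes "X \<subseteq> {l..<u}" and down: "\<And>x y. y \<in> X \<Longrightarrow> l \<le> x \<Longrightarrow> x \<le> y \<Longrightarrow> x \<in> X"
  shows "X = {l..<l + card X}"
proof -
  have fin: "finite X" using assms(1) finite_subset by blast
  show ?thesis
  proof (cases "X = {}")
    case False
    have m: "Max X \<in> X" using fin False by (rule Max_in)
    have eq: "X = {l..<Suc (Max X)}"
    proof (intro equalityI subsetI)
      fix x assume "x \<in> X"
      then show "x \<in> {l..<Suc (Max X)}"
        using assms(1) Max_ge[OF fin] by (auto simp: less_Suc_eq_le)
    next
      fix x assume "x \<in> {l..<Suc (Max X)}"
      then show "x \<in> X" using down[OF m, of x] by simp
    qed
    have "l \<le> Max X" using m assms(1) by auto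
    moreover have "card X = Suc (Max X) - l" by (subst eq) simp
    ultimately have "Suc (Max X) = l + card X" by simp
    with eq show ?thesis by simp
  qed simp
qed

text \<open>Let \<open>S\<close> be the set of positions with values at most \<open>i\<close>. As
  \<open>v\<close> increases up to \<open>j\<close> and after \<open>j\<close>, \<open>S\<close> is
  an initial segment of each side. As the inverse increases up to \<open>i\<close> and after
  \<open>i\<close>, \<open>S\<close> determines the relative order of all values.\<close>

lemma bigrassmannian_block_swap:
  assumes "bigrassmannian n v"
  obtains I J a where "a < I" "a < J" "I + J \<le> n + a" "v = block_swap I J a"
proof -
  let ?w = "inv_into UNIV v"
  have v: "v permutes {..<n}" using assms by (simp add: bigrassmannian_def)
  define R where "R i j \<longleftrightarrow> Suc i < n \<and> Suc j < n \<and> ?w i > ?w (Suc i) \<and> v j > v (Suc j)" for i j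
  have "\<exists>!(i, j). R i j" using assms by (simp add: bigrassmannian_def R_def)
  then obtain i j where R: "R i j" and R_unique: "\<And>i' j'. R i' j' \<Longrightarrow> i' = i \<and> j' = j"
    by (elim ex1E) fast
  have ij: "Suc i < n" "Suc j < n" "?w i > ?w (Suc i)" "v j > v (Suc j)"
    using R by (simp_all add: R_def)
  have wv: "?w (v x) = x" for x using permutes_inverses(2)[OF v] .
  have vn: "v x < n \<longleftrightarrow> x < n" for x using permutes_in_image[OF v, of x] by simp
  \<comment> \<open>Another descent \<open>z\<close> of \<open>v\<close> would give a second pair
    \<open>(i, z)\<close>; symmetrically for the inverse.\<close>
  have v_asc: "v z \<le> v (Suc z)" if "Suc z < n" "z \<noteq> j" for z
    using R_unique[of i z] ij that by (force simp: R_def not_le)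
  have w_asc: "?w z \<le> ?w (Suc z)" if "Suc z < n" "z \<noteq> i" for z
    using R_unique[of z j] ij that by (force simp: R_def not_le)
  have v_mono: "v x \<le> v y" if "x \<le> y" "y < n" "y \<le> j \<or> j < x" for x y
    by (rule mono_of_no_descent[where f = v, OF v_asc]) (use that in auto)
  have w_mono: "?w x \<le> ?w y" if "x \<le> y" "y < n" "y \<le> i \<or> i < x" for x y
    by (rule mono_of_no_descent[where f = ?w, OF w_asc]) (use that in auto)
  have same: "x \<le> y" if "v x \<le> v y" "y < n" "v x \<le> i \<longleftrightarrow> v y \<le> i" for x y
    using w_mono[of "v x" "v y"] that by (auto simp: wv vn)
  define S where "S = {x. x < n \<and> v x \<le> i}"
  define a where "a = card (S \<inter> {..j})"
  define b where "b = card (S - {..j})"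
  have S1: "S \<inter> {..j} = {0..<0 + a}"
    unfolding a_def
  proof (rule initial_segment)
    show "S \<inter> {..j} \<subseteq> {0..<Suc j}" by auto
  next
    fix x y assume "y \<in> S \<inter> {..j}" "x \<le> y"
    then show "x \<in> S \<inter> {..j}" using v_mono[of x y] by (auto simp: S_def)
  qed
  have S2: "S - {..j} = {Suc j..<Suc j + b}"
    unfolding b_def
  proof (rule initial_segment)
    show "S - {..j} \<subseteq> {Suc j..<n}" by (auto simp: S_def)
  next
    fix x y assume "y \<in> S - {..j}" "Suc j \<le> x" "x \<le> y"
    then show "x \<in> S - {..j}" using v_mono[of x y] by (auto simp: S_def)
  qed
  have in_S: "x \<in> S \<longleftrightarrow> x < a \<or> (Suc j \<le> x \<and> x < Suc j + b)" for x
    by (subst Un_Diff_Int[of S "{..j}", unfolded S1 S2, symmetric]) auto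
  have "v ` S = {..i}"
  proof (intro Set.set_eqI iffI)
    fix z assume "z \<in> {..i}"
    then have "z \<in> v ` {..<n}" using permutes_image[OF v] ij by auto
    with \<open>z \<in> {..i}\<close> show "z \<in> v ` S" by (auto simp: S_def)
  qed (auto simp: S_def)
  then have "card S = Suc i"
    by (metis card_atMost card_image inj_on_subset permutes_inj[OF v] subset_UNIV)
  moreover have "finite S" by (simp add: S_def)
  ultimately have ab: "a + b = Suc i"
    unfolding a_def b_def by (metis card_Int_Diff)
  \<comment> \<open>If \<open>j\<close> and \<open>Suc j\<close> were both in \<open>S\<close> or
    both outside it, \<open>same\<close> would contradict the descent at \<open>j\<close>; so they
    are separated, and the smaller value is in \<open>S\<close>.\<close>
  have "j \<notin> S" "Suc j \<in> S"
    using same[of "Suc j" j] same[of j "Suc j"] ij by (force simp: S_def)+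
  then have "a \<le> j" "0 < b" using in_S by force+
  moreover have "Suc j + b \<le> n"
  proof -
    have "j + b \<in> S" using \<open>0 < b\<close> in_S by auto
    then show ?thesis by (simp add: S_def)
  qed
  ultimately have bounds: "a < Suc j" "a < Suc i" "Suc j + Suc i \<le> n + a" using ab by auto
  have "v = block_swap (Suc j) (Suc i) a"
  proof (rule permutes_eqI_order[OF v block_swap_permutes[OF bounds]])
    fix x y assume xy: "x < n" "y < n"
    \<comment> \<open>Positions in \<open>S\<close> carry the smaller values; within
      \<open>S\<close> and within its complement, values follow the positions.\<close>
    have *: "v x < v y \<longleftrightarrow> (if x \<in> S then y \<in> S \<longrightarrow> x < y else y \<notin> S \<and> x < y)"
    proof (cases "x \<in> S \<longleftrightarrow> y \<in> S")
      case True
      then have "v x < v y \<longleftrightarrow> x < y"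
        using same[of x y] same[of y x] xy by (force simp: S_def not_less nat_less_le)
      with True show ?thesis by auto
    qed (use xy in \<open>auto simp: S_def\<close>)
    show "v x < v y \<longleftrightarrow> block_swap (Suc j) (Suc i) a x < block_swap (Suc j) (Suc i) a y"
      unfolding * in_S using ab bounds by (auto simp: block_swap_def)
  qed
  with bounds that show thesis by blast
qed

section \<open>Counting the bigrassmannian permutations below a matrix\<close>

text \<open>The parameters can be read off: \<open>a\<close> is the first moved point, its value is
  \<open>J\<close>, and \<open>I\<close> is the position with value \<open>a\<close>.\<close>

lemma block_swap_inject:
  assumes "a < I" "a < J" "I + J \<le> n + a" "a' < I'" "a' < J'" "I' + J' \<le> n + a'"
    and "perm_mat n (block_swap I J a) = perm_mat n (block_swap I' J' a')"
  shows "I = I' \<and> J = J' \<and> a = a'"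
proof -
  have eq: "block_swap I J a x = block_swap I' J' a' x" if "x < n" for x
  proof -
    have "block_swap I J a x < n"
      using permutes_in_image[OF block_swap_permutes[OF assms(1-3)], of x] that by simp
    moreover have "perm_mat n (block_swap I' J' a') $$ (x, block_swap I J a x) = 1"
      using that \<open>block_swap I J a x < n\<close> unfolding assms(7)[symmetric] by (simp add: perm_mat_def)
    ultimately show ?thesis using that by (simp add: perm_mat_def split: if_splits)
  qed
  have "a = a'"
    using eq[of a] eq[of a'] assms by (auto simp: block_swap_def split: if_splits)
  moreover from this have "J = J'"
    using eq[of a] assms by (auto simp: block_swap_def)
  moreover have "I = I'"
    using eq[of I] eq[of I'] assms \<open>a = a'\<close> \<open>J = J'\<close>
    by (auto simp: block_swap_def split: if_splits)
  ultimately show ?thesis by simp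
qed

lemma asm_beta_eq_corner_defect:
  assumes A: "A \<in> ASM n"
  shows "int (asm_beta n A) = (\<Sum>i<n. \<Sum>j<n. int (min (Suc i) (Suc j)) - corner A (Suc i) (Suc j))"
proof -
  define T where "T = (SIGMA i:{..<n}. SIGMA j:{..<n}.
    {nat (corner A (Suc i) (Suc j))..<min (Suc i) (Suc j)})"
  define F where "F = (\<lambda>(i, j, a). perm_mat n (block_swap (Suc i) (Suc j) a))"
  \<comment> \<open>The condition that the blocks fit into \<open>n\<close> letters is absent from
    \<open>T\<close>: it follows from \<open>corner_lower_bound\<close> and the lower bound on
    \<open>a\<close>.\<close>
  have T_iff: "(i, j, a) \<in> T \<longleftrightarrow> a < Suc i \<and> a < Suc j \<and> Suc i + Suc j \<le> n + a
      \<and> corner A (Suc i) (Suc j) \<le> int a" for i j a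
  proof (cases "i < n \<and> j < n")
    case True
    then show ?thesis
      using corner_lower_bound[OF A, of "Suc i" "Suc j"] by (auto simp: T_def)
  qed (auto simp: T_def)
  have "inj_on F T"
  proof (rule inj_onI)
    fix s t assume "s \<in> T" "t \<in> T" "F s = F t"
    moreover obtain i j a i' j' a' where "s = (i, j, a)" "t = (i', j', a')"
      by (metis prod_cases3)
    ultimately show "s = t"
      using block_swap_inject[of a "Suc i" "Suc j" n a' "Suc i'" "Suc j'"]
      by (auto simp: F_def T_iff)
  qed
  moreover have "F ` T = {B \<in> ASM n. asm_le n B A \<and> (\<exists>v. bigrassmannian n v \<and> B = perm_mat n v)}"
  proof (intro Set.set_eqI iffI)
    fix B assume "B \<in> F ` T"
    then obtain i j a where "(i, j, a) \<in> T" and B: "B = perm_mat n (block_swap (Suc i) (Suc j) a)"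
      by (auto simp: F_def)
    then have *: "a < Suc i" "a < Suc j" "Suc i + Suc j \<le> n + a" "corner A (Suc i) (Suc j) \<le> int a"
      by (auto simp: T_iff)
    then show "B \<in> {B \<in> ASM n. asm_le n B A \<and> (\<exists>v. bigrassmannian n v \<and> B = perm_mat n v)}"
      using perm_mat_ASM[OF block_swap_permutes[OF *(1-3)]] block_swap_le_iff[OF *(1-3) A]
        block_swap_bigrassmannian[OF *(1-3)] B by blast
  next
    fix B assume "B \<in> {B \<in> ASM n. asm_le n B A \<and> (\<exists>v. bigrassmannian n v \<and> B = perm_mat n v)}"
    then obtain v where le: "asm_le n B A" and v: "bigrassmannian n v" and B: "B = perm_mat n v"
      by blast
    from v obtain I J a where *: "a < I" "a < J" "I + J \<le> n + a" and "v = block_swap I J a"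
      by (rule bigrassmannian_block_swap)
    moreover from this have "corner A I J \<le> int a"
      using le B block_swap_le_iff[OF * A] by simp
    ultimately have "(I - 1, J - 1, a) \<in> T" "B = F (I - 1, J - 1, a)"
      using B by (auto simp: T_iff F_def)
    then show "B \<in> F ` T" by blast
  qed
  ultimately have "asm_beta n A = card T"
    unfolding asm_beta_def by (metis card_image)
  also have "card T = (\<Sum>i<n. \<Sum>j<n. min (Suc i) (Suc j) - nat (corner A (Suc i) (Suc j)))"
    unfolding T_def by (simp del: min_Suc_Suc)
  also have "int \<dots> = (\<Sum>i<n. \<Sum>j<n. int (min (Suc i) (Suc j)) - corner A (Suc i) (Suc j))"
    unfolding of_nat_sum
  proof (intro sum.cong refl)
    fix i j assume "i \<in> {..<n}" "j \<in> {..<n}"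
    then have "0 \<le> corner A (Suc i) (Suc j)" "corner A (Suc i) (Suc j) \<le> int (min (Suc i) (Suc j))"
      using corner_nonneg[OF A] corner_le_min[OF A] by (auto simp del: min_Suc_Suc)
    then show "int (min (Suc i) (Suc j) - nat (corner A (Suc i) (Suc j)))
        = int (min (Suc i) (Suc j)) - corner A (Suc i) (Suc j)"
      by linarith
  qed
  finally show ?thesis .
qed

section \<open>The double sum as a count of inversions\<close>

lemma sum_strict_pairs:
  fixes f :: "nat \<Rightarrow> nat \<Rightarrow> 'a::comm_monoid_add"
  shows "(\<Sum>(i, j) \<in> {(i, j). i < j \<and> j < n}. f i j) = (\<Sum>j<n. \<Sum>i<j. f i j)"
proof -
  have "(\<Sum>j<n. \<Sum>i<j. f i j) = (\<Sum>(j, i)\<in>(SIGMA j:{..<n}. {..<j}). f i j)"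
    by (rule sum.Sigma) auto
  also have "\<dots> = (\<Sum>(i, j) \<in> {(i, j). i < j \<and> j < n}. f i j)"
    by (rule sum.reindex_bij_witness[where i = prod.swap and j = prod.swap]) auto
  finally show ?thesis by simp
qed

text \<open>Regroup by the cut \<open>m\<close> with \<open>k \<le> m < l\<close>: the indices
  \<open>k\<close> up to the cut give a partial sum of \<open>x\<close>, the indices
  \<open>l\<close> after it a tail of \<open>y\<close>.\<close>

lemma sum_difference_weighted:
  fixes x y :: "nat \<Rightarrow> int"
  shows "(\<Sum>(k, l) \<in> {(k, l). k < l \<and> l < n}. (int l - int k) * x k * y l)
    = (\<Sum>m<n. (\<Sum>k\<le>m. x k) * ((\<Sum>l<n. y l) - (\<Sum>l\<le>m. y l)))"
proof (induction n)
  case 0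
  then show ?case by (simp add: sum_strict_pairs)
next
  case (Suc n)
  have weights: "(\<Sum>k<n. (int n - int k) * x k) = (\<Sum>m<n. \<Sum>k\<le>m. x k)"
  proof (induction n)
    case (Suc n)
    have "(\<Sum>k<Suc n. (int (Suc n) - int k) * x k) = (\<Sum>k<n. (int n - int k) * x k) + (\<Sum>k\<le>n. x k)"
      by (simp add: left_diff_distrib distrib_right sum.distrib sum_subtractf flip: lessThan_Suc_atMost)
    with Suc show ?case by simp
  qed simp
  have "(\<Sum>k<n. (int n - int k) * x k * y n) = (\<Sum>m<n. (\<Sum>k\<le>m. x k) * y n)"
    using weights by (simp flip: sum_distrib_right)
  \<comment> \<open>The term \<open>m = n\<close> vanishes because the tail of \<open>y\<close>
    beyond \<open>n\<close> is empty.\<close>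
  moreover have "(\<Sum>m<Suc n. (\<Sum>k\<le>m. x k) * ((\<Sum>l<Suc n. y l) - (\<Sum>l\<le>m. y l)))
      = (\<Sum>m<n. (\<Sum>k\<le>m. x k) * ((\<Sum>l<n. y l) - (\<Sum>l\<le>m. y l)) + (\<Sum>k\<le>m. x k) * y n)"
    by (simp add: distrib_left[symmetric] lessThan_Suc_atMost[symmetric] del: sum.lessThan_Suc)
      (simp add: algebra_simps)
  ultimately show ?case
    using Suc by (simp add: sum_strict_pairs sum.distrib del: sum.lessThan_Suc)
      (simp add: sum.lessThan_Suc)
qed

text \<open>The left side counts zeros standing before ones; the minima are the partial sums after
  moving all ones to the front. Exchanging an adjacent zero and one into that order lowers both
  sides by one. The induction instead appends a last entry.\<close>

lemma zero_one_inversions: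
  fixes c :: "nat \<Rightarrow> int"
  assumes "\<And>i. i < n \<Longrightarrow> c i \<in> {0, 1}"
  shows "(\<Sum>j<n. \<Sum>i<j. c j * (1 - c i))
    = (\<Sum>i<n. min (int (Suc i)) (\<Sum>p<n. c p) - (\<Sum>p<Suc i. c p))"
  using assms
proof (induction n)
  case (Suc n)
  define M where "M = (\<Sum>p<n. c p)"
  have M: "0 \<le> M" "M \<le> int n"
    using sum_zero_one_le[of n c 0 n] sum_zero_one_le[of n c n 0] Suc.prems
    unfolding M_def by auto
  \<comment> \<open>Raising the cap from \<open>M\<close> to \<open>M + 1\<close> matters exactly
    for \<open>i \<ge> M\<close>. For \<open>k = n\<close> the gain \<open>n - M\<close> is the
    number of zeros preceding an appended one.\<close>
  have shift: "(\<Sum>i<k. min (int (Suc i)) (M + 1)) = (\<Sum>i<k. min (int (Suc i)) M) + max 0 (int k - M)" for k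
    using M(1) by (induction k) auto
  have IH: "(\<Sum>j<n. \<Sum>i<j. c j * (1 - c i)) = (\<Sum>i<n. min (int (Suc i)) M - (\<Sum>p<Suc i. c p))"
    unfolding M_def by (rule Suc.IH) (use Suc.prems in auto)
  have new: "(\<Sum>i<n. c n * (1 - c i)) = c n * (int n - M)"
    by (simp add: M_def sum_subtractf flip: sum_distrib_left)
  have total: "(\<Sum>p<Suc n. c p) = M + c n" by (simp add: M_def)
  have "c n = 0 \<or> c n = 1" using Suc.prems[of n] by auto
  then have "(\<Sum>i<n. min (int (Suc i)) M) + c n * (int n - M)
      = (\<Sum>i<Suc n. min (int (Suc i)) (M + c n)) - (M + c n)"
    using M shift[of n] by auto
  moreover have "(\<Sum>i<Suc n. \<Sum>p<Suc i. c p) = (\<Sum>i<n. \<Sum>p<Suc i. c p) + (M + c n)"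
    by (simp add: M_def)
  ultimately show ?case
    unfolding total sum_subtractf sum.lessThan_Suc[of "\<lambda>j. \<Sum>i<j. c j * (1 - c i)"] IH new
    by linarith
qed simp

section \<open>Equality of the two counts\<close>

theorem theorem1p6:
  fixes n :: nat and A :: "int mat"
  assumes "n \<ge> 1" and "A \<in> ASM n"
  shows "int (asm_beta n A) =
    (\<Sum>(i, j) \<in> {(i, j). i < j \<and> j < n}. \<Sum>(k, l) \<in> {(k, l). k < l \<and> l < n}.
       (int l - int k) * A $$ (j, k) * A $$ (i, l))"
proof -
  define c where "c m i = (\<Sum>k<Suc m. A $$ (i, k))" for m i
  have c01: "c m i \<in> {0, 1}" if "i < n" "m < n" for m i
    unfolding c_def by (rule ASM_row_partial[OF assms(2)]) (use that in auto)
  have c_corner: "(\<Sum>p<q. c m p) = corner A q (Suc m)" for m q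
    by (simp add: corner_def c_def)
  \<comment> \<open>Cut between columns \<open>m\<close> and \<open>m + 1\<close>. Row
    \<open>i\<close> has total one, so its tail after the cut is \<open>1 - c m i\<close>.\<close>
  have "(\<Sum>(i, j) \<in> {(i, j). i < j \<and> j < n}. \<Sum>(k, l) \<in> {(k, l). k < l \<and> l < n}.
       (int l - int k) * A $$ (j, k) * A $$ (i, l))
    = (\<Sum>j<n. \<Sum>i<j. \<Sum>m<n. c m j * (1 - c m i))"
    unfolding sum_difference_weighted
      sum_strict_pairs[of "\<lambda>i j. \<Sum>m<n. (\<Sum>k\<le>m. A $$ (j, k)) * ((\<Sum>l<n. A $$ (i, l)) - (\<Sum>l\<le>m. A $$ (i, l)))"]
    by (intro sum.cong refl)
      (simp add: c_def ASM_row_total[OF assms(2)] lessThan_Suc_atMost del: sum.lessThan_Suc)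
  also have "\<dots> = (\<Sum>j<n. \<Sum>m<n. \<Sum>i<j. c m j * (1 - c m i))"
    by (intro sum.cong refl sum.swap)
  also have "\<dots> = (\<Sum>m<n. \<Sum>j<n. \<Sum>i<j. c m j * (1 - c m i))"
    by (rule sum.swap)
  also have "\<dots> = (\<Sum>m<n. \<Sum>i<n. int (min (Suc i) (Suc m)) - corner A (Suc i) (Suc m))"
  proof (rule sum.cong[OF refl])
    fix m assume "m \<in> {..<n}"
    then have "(\<Sum>j<n. \<Sum>i<j. c m j * (1 - c m i))
        = (\<Sum>i<n. min (int (Suc i)) (\<Sum>p<n. c m p) - (\<Sum>p<Suc i. c m p))"
      by (intro zero_one_inversions c01) auto
    then show "(\<Sum>j<n. \<Sum>i<j. c m j * (1 - c m i))
        = (\<Sum>i<n. int (min (Suc i) (Suc m)) - corner A (Suc i) (Suc m))"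
      \<comment> \<open>The number of ones in \<open>c m\<close> is the sum of the first
        \<open>m + 1\<close> columns, namely \<open>m + 1\<close>.\<close>
      using \<open>m \<in> {..<n}\<close> unfolding c_corner
      by (simp add: corner_full_rows[OF assms(2)] of_nat_min del: min_Suc_Suc)
  qed
  also have "\<dots> = int (asm_beta n A)"
    unfolding asm_beta_eq_corner_defect[OF assms(2)] by (rule sum.swap)
  finally show ?thesis by simp
qed

end
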